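(* Suppose that $\min\{M,\,N+2-N',\,M+2-M'\}>N$, that scalar functions $h_0,h_1,\dots,h_k$ of $x$ are given, where $0\le k\le N$, and that $T_0$ assumes values in some matrix Lie group $G$ with Lie algebra $\mathfrak g$. Then the following system of $k+1$ linear constraints is invariant with respect to the Darboux transformation: $$u_j+\sum_{i=0}^{j}h_iv_{j-i}=0\quad(j=0,1,\dots,k-1),\qquad u_k+\sum_{i=0}^{k}h_iv_{k-i}\in\mathfrak g ;$$ that is, if it holds for the coefficients $u_j,v_j$, then it holds for $\tilde u_j,\tilde v_j$ (with the same $h_i$).
   Context: $x=(x^1,x^2)$; $,_1,,_2$ denote derivatives with respect to $x^1,x^2$, taking into account the possible dependence of the spectral parameter $\lambda$ on $x$. The linear problem $\Psi,_1=U\Psi$, $\Psi,_2=V\Psi$ has $n\times n$ matrices $$U=\sum_{k=0}^\infty u_k\lambda^{N-k},\qquad V=\sum_{k=0}^\infty v_k\lambda^{M-k},$$ for $\lambda$ near $\infty$, with $N,M$ fixed positive integers and $u_k=u_k(x)$, $v_k=v_k(x)$ (usually only finitely many are nonzero). The spectral parameter satisfies $$\lambda,_1=\sum_{k=0}^\infty a_k\lambda^{N'-k},\qquad \lambda,_2=\sum_{k=0}^\infty b_k\lambda^{M'-k},$$ with scalar $a_k=a_k(x)$, $b_k=b_k(x)$ and given integers $N',M'$ (in the nonisospectral case fixed by requiring $a_0\ne0$, $b_0\ne0$; the isospectral case is $\lambda,_1=\lambda,_2=0$). A Darboux transformation replaces $U,V$ by $$\tilde U=D,_1D^{-1}+DUD^{-1},\qquad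 \tilde V=D,_2D^{-1}+DVD^{-1},$$ where the Darboux matrix $D$ is analytic at $\lambda=\infty$, $D=T_0+T_1\lambda^{-1}+T_2\lambda^{-2}+\dots$ with $T_k=T_k(x)$, $\det T_0\ne0$, and is such that $\tilde U,\tilde V$ are of the same form as $U,V$: $\tilde U=\sum_{k\ge0}\tilde u_k\lambda^{N-k}$, $\tilde V=\sum_{k\ge0}\tilde v_k\lambda^{M-k}$. *)

theory Defs
  imports "HOL-Complex_Analysis.Complex_Analysis"
begin

text \<open>
  Points of the plane are pairs \<open>x = (x1, x2)\<close> of reals; \<open>l\<close> stands for the spectral parameter.
  A quantity depending on both is a curried function of \<open>x\<close> and \<open>l\<close>.
\<close>

definition smult_mat :: "complex \<Rightarrow> complex^'n^'n \<Rightarrow> complex^'n^'n" (infixr "*\<^sub>M" 75)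
  where "c *\<^sub>M A = (\<chi> i j. c * A $ i $ j)"

text \<open>
  Expansions \<open>c\<^sub>0 l\<^sup>d + c\<^sub>1 l\<^sup>d\<^sup>-\<^sup>1 + \<dots>\<close>, convergent for \<open>l\<close> near infinity (how near may depend on \<open>x\<close>).
\<close>

definition expansion :: "(real \<times> real) set \<Rightarrow> int \<Rightarrow> (nat \<Rightarrow> real \<times> real \<Rightarrow> complex)
    \<Rightarrow> (real \<times> real \<Rightarrow> complex \<Rightarrow> complex) \<Rightarrow> bool"
  where "expansion \<Omega> d c F \<longleftrightarrow>
    (\<forall>x\<in>\<Omega>. \<forall>\<^sub>F l in at_infinity. (\<lambda>k. c k x * l powi (d - int k)) sums F x l)"

definition mat_expansion :: "(real \<times> real) set \<Rightarrow> int \<Rightarrow> (nat \<Rightarrow> real \<times> real \<Rightarrow> complex^'n^'n)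
    \<Rightarrow> (real \<times> real \<Rightarrow> complex \<Rightarrow> complex^'n^'n) \<Rightarrow> bool"
  where "mat_expansion \<Omega> d c F \<longleftrightarrow>
    (\<forall>x\<in>\<Omega>. \<forall>\<^sub>F l in at_infinity. (\<lambda>k. (l powi (d - int k)) *\<^sub>M c k x) sums F x l)"

text \<open>Partial derivatives, at fixed \<open>l\<close> and at fixed \<open>x\<close> respectively.\<close>

definition dx1 :: "(real \<times> real \<Rightarrow> complex \<Rightarrow> complex^'n^'n) \<Rightarrow> real \<times> real \<Rightarrow> complex \<Rightarrow> complex^'n^'n"
  where "dx1 F x l = vector_derivative (\<lambda>t. F (t, snd x) l) (at (fst x))"

definition dx2 :: "(real \<times> real \<Rightarrow> complex \<Rightarrow> complex^'n^'n) \<Rightarrow> real \<times> real \<Rightarrow> complex \<Rightarrow> complex^'n^'n"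
  where "dx2 F x l = vector_derivative (\<lambda>t. F (fst x, t) l) (at (snd x))"

definition dlam :: "(real \<times> real \<Rightarrow> complex \<Rightarrow> complex^'n^'n) \<Rightarrow> real \<times> real \<Rightarrow> complex \<Rightarrow> complex^'n^'n"
  where "dlam F x l = (\<chi> i j. deriv (\<lambda>m. F x m $ i $ j) l)"

text \<open>
  Derivatives that take into account the dependence of the spectral parameter on \<open>x\<close> (chain
  rule). The spectral parameter obeys \<open>\<lambda>,\<^sub>1 = L1 x \<lambda>\<close> and \<open>\<lambda>,\<^sub>2 = L2 x \<lambda>\<close>; the isospectral case is
  \<open>L1 = L2 = 0\<close>.
\<close>

definition total1 :: "(real \<times> real \<Rightarrow> complex \<Rightarrow> complex) \<Rightarrow> (real \<times> real \<Rightarrow> complex \<Rightarrow> complex^'n^'n)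
    \<Rightarrow> real \<times> real \<Rightarrow> complex \<Rightarrow> complex^'n^'n"
  where "total1 L1 F x l = dx1 F x l + L1 x l *\<^sub>M dlam F x l"

definition total2 :: "(real \<times> real \<Rightarrow> complex \<Rightarrow> complex) \<Rightarrow> (real \<times> real \<Rightarrow> complex \<Rightarrow> complex^'n^'n)
    \<Rightarrow> real \<times> real \<Rightarrow> complex \<Rightarrow> complex^'n^'n"
  where "total2 L2 F x l = dx2 F x l + L2 x l *\<^sub>M dlam F x l"

definition darboux1 :: "(real \<times> real \<Rightarrow> complex \<Rightarrow> complex) \<Rightarrow> (real \<times> real \<Rightarrow> complex \<Rightarrow> complex^'n^'n)
    \<Rightarrow> (real \<times> real \<Rightarrow> complex \<Rightarrow> complex^'n^'n) \<Rightarrow> real \<times> real \<Rightarrow> complex \<Rightarrow> complex^'n^'n"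
  where "darboux1 L1 D U x l =
    total1 L1 D x l ** matrix_inv (D x l) + D x l ** U x l ** matrix_inv (D x l)"

definition darboux2 :: "(real \<times> real \<Rightarrow> complex \<Rightarrow> complex) \<Rightarrow> (real \<times> real \<Rightarrow> complex \<Rightarrow> complex^'n^'n)
    \<Rightarrow> (real \<times> real \<Rightarrow> complex \<Rightarrow> complex^'n^'n) \<Rightarrow> real \<times> real \<Rightarrow> complex \<Rightarrow> complex^'n^'n"
  where "darboux2 L2 D V x l =
    total2 L2 D x l ** matrix_inv (D x l) + D x l ** V x l ** matrix_inv (D x l)"

text \<open>
  Smoothness near \<open>l = \<infinity>\<close>: locally uniformly in \<open>x\<close>, the function is holomorphic in \<open>l\<close> and has
  first partial derivatives in \<open>x\<close> that are jointly continuous in \<open>(x, l)\<close>.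
\<close>

definition smooth_near_infinity :: "(real \<times> real) set \<Rightarrow>
    (real \<times> real \<Rightarrow> complex \<Rightarrow> complex^'n^'n) \<Rightarrow> bool"
  where "smooth_near_infinity \<Omega> F \<longleftrightarrow>
    (\<forall>x0\<in>\<Omega>. \<forall>\<^sub>F (x, l) in nhds x0 \<times>\<^sub>F at_infinity.
       (\<forall>i j. (\<lambda>m. F x m $ i $ j) field_differentiable at l) \<and>
       (\<lambda>t. F (t, snd x) l) differentiable at (fst x) \<and>
       (\<lambda>t. F (fst x, t) l) differentiable at (snd x) \<and>
       isCont (\<lambda>(y, m). dx1 F y m) (x, l) \<and>
       isCont (\<lambda>(y, m). dx2 F y m) (x, l))"

text \<open>
  \<open>D\<close> is analytic at \<open>l = \<infinity>\<close> with expansion \<open>T\<^sub>0 + T\<^sub>1 l\<^sup>-\<^sup>1 + \<dots>\<close>, \<open>T\<^sub>0\<close> is nondegenerate, and the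
  transforms of \<open>U\<close>, \<open>V\<close> have expansions of the same form as \<open>U\<close>, \<open>V\<close>, with coefficients
  \<open>u'\<close>, \<open>v'\<close>.
\<close>

definition darboux_transformation :: "(real \<times> real) set \<Rightarrow> nat \<Rightarrow> nat
    \<Rightarrow> (real \<times> real \<Rightarrow> complex \<Rightarrow> complex) \<Rightarrow> (real \<times> real \<Rightarrow> complex \<Rightarrow> complex)
    \<Rightarrow> (real \<times> real \<Rightarrow> complex \<Rightarrow> complex^'n^'n) \<Rightarrow> (real \<times> real \<Rightarrow> complex \<Rightarrow> complex^'n^'n)
    \<Rightarrow> (real \<times> real \<Rightarrow> complex \<Rightarrow> complex^'n^'n) \<Rightarrow> (nat \<Rightarrow> real \<times> real \<Rightarrow> complex^'n^'n)
    \<Rightarrow> (nat \<Rightarrow> real \<times> real \<Rightarrow> complex^'n^'n) \<Rightarrow> (nat \<Rightarrow> real \<times> real \<Rightarrow> complex^'n^'n) \<Rightarrow> bool"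
  where "darboux_transformation \<Omega> N M L1 L2 U V D T u' v' \<longleftrightarrow>
    smooth_near_infinity \<Omega> D \<and>
    mat_expansion \<Omega> 0 T D \<and>
    (\<forall>x\<in>\<Omega>. det (T 0 x) \<noteq> 0) \<and>
    mat_expansion \<Omega> (int N) u' (darboux1 L1 D U) \<and>
    mat_expansion \<Omega> (int M) v' (darboux2 L2 D V)"

text \<open>
  A matrix Lie group is a subgroup of the general linear group over the complex numbers that is
  closed in it; real matrix groups are included.
\<close>

definition matrix_lie_group :: "(complex^'n^'n) set \<Rightarrow> bool"
  where "matrix_lie_group G \<longleftrightarrow>
    G \<subseteq> {A. invertible A} \<and>
    closedin (top_of_set {A. invertible A}) G \<and>
    mat 1 \<in> G \<and>
    (\<forall>A\<in>G. \<forall>B\<in>G. A ** B \<in> G) \<and>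
    (\<forall>A\<in>G. matrix_inv A \<in> G)"

text \<open>Its Lie algebra is the tangent space at the identity: the velocities of curves in the group.\<close>

definition lie_algebra :: "(complex^'n^'n) set \<Rightarrow> (complex^'n^'n) set"
  where "lie_algebra G = {A. \<exists>\<gamma> :: real \<Rightarrow> complex^'n^'n. \<exists>\<epsilon>>0.
    \<gamma> 0 = mat 1 \<and>
    (\<forall>t\<in>{-\<epsilon><..<\<epsilon>}. \<gamma> t \<in> G \<and> \<gamma> differentiable at t) \<and>
    (\<gamma> has_vector_derivative A) (at 0)}"

definition linear_constraints :: "(real \<times> real) set \<Rightarrow> (complex^'n^'n) set \<Rightarrow> nat
    \<Rightarrow> (nat \<Rightarrow> real \<times> real \<Rightarrow> complex) \<Rightarrow> (nat \<Rightarrow> real \<times> real \<Rightarrow> complex^'n^'n)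
    \<Rightarrow> (nat \<Rightarrow> real \<times> real \<Rightarrow> complex^'n^'n) \<Rightarrow> bool"
  where "linear_constraints \<Omega> g k h u v \<longleftrightarrow>
    (\<forall>x\<in>\<Omega>.
       (\<forall>j<k. u j x + (\<Sum>i=0..j. h i x *\<^sub>M v (j - i) x) = 0) \<and>
       u k x + (\<Sum>i=0..k. h i x *\<^sub>M v (k - i) x) \<in> g)"

end

theory Submission
  imports Defs
begin

text \<open>
  Put \<open>W = U + H V\<close> with the scalar \<open>H = \<Sum>\<^sub>i\<^sub>\<le>\<^sub>k h\<^sub>i l\<^sup>N\<^sup>-\<^sup>M\<^sup>-\<^sup>i\<close>. The left-hand sides of the constraints are the
  first \<open>k + 1\<close> coefficients of the expansion of \<open>W\<close> in descending powers of \<open>l\<close>, starting at \<open>l\<^sup>N\<close>.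
  Its transform satisfies \<open>W' D = D,\<^sub>1 + H D,\<^sub>2 + D W\<close>, and the degree hypotheses ensure that everything
  in \<open>D,\<^sub>1 + H D,\<^sub>2\<close> except the \<open>l\<^sup>0\<close> term \<open>T\<^sub>0,\<^sub>1\<close> tends to \<open>0\<close> as \<open>l\<close> tends to \<open>\<infinity>\<close>. Comparing leading
  coefficients, \<open>W'\<close> begins at \<open>l\<^sup>N\<^sup>-\<^sup>k\<close> with coefficient \<open>T\<^sub>0 w\<^sub>k T\<^sub>0\<^sup>-\<^sup>1\<close>, to which \<open>T\<^sub>0,\<^sub>1 T\<^sub>0\<^sup>-\<^sup>1\<close> is added
  if \<open>k = N\<close>; both lie in the Lie algebra. That \<open>T\<^sub>0\<close> is differentiable in \<open>x\<close>, and that the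
  \<open>x\<close>-derivatives of \<open>D\<close> converge as \<open>l\<close> tends to \<open>\<infinity>\<close>, comes from Cauchy's integral formula in the variable
  \<open>1/l\<close>, differentiated under the integral sign.
\<close>

section \<open>Calculus of matrix-valued functions: bounded bilinear products, entrywise limits and
  derivatives\<close>

lemma bounded_bilinear_matrix_matrix_mult:
  "bounded_bilinear ((**) :: complex^'n^'n \<Rightarrow> complex^'n^'n \<Rightarrow> complex^'n^'n)"
proof -
  have "bilinear ((**) :: complex^'n^'n \<Rightarrow> complex^'n^'n \<Rightarrow> complex^'n^'n)"
    unfolding bilinear_def
    by (auto intro!: linearI simp: vec_eq_iff matrix_matrix_mult_def
        scaleR_sum_right sum.distrib algebra_simps)
  then show ?thesis by (simp add: bilinear_conv_bounded_bilinear)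
qed

lemma smult_mat_nth [simp]: "(c *\<^sub>M A) $ i $ j = c * A $ i $ j"
  by (simp add: smult_mat_def)

lemma one_smult_mat [simp]: "1 *\<^sub>M A = A"
  by (simp add: vec_eq_iff)

lemma smult_mat_matrix_mult:
  fixes A B :: "complex^'n^'n"
  shows "c *\<^sub>M A ** B = c *\<^sub>M (A ** B)" "A ** c *\<^sub>M B = c *\<^sub>M (A ** B)"
  by (simp_all add: vec_eq_iff matrix_matrix_mult_def sum_distrib_left ac_simps)

lemma bounded_bilinear_smult_mat:
  "bounded_bilinear ((*\<^sub>M) :: complex \<Rightarrow> complex^'n^'n \<Rightarrow> complex^'n^'n)"
proof -
  have "bilinear ((*\<^sub>M) :: complex \<Rightarrow> complex^'n^'n \<Rightarrow> complex^'n^'n)"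
    unfolding bilinear_def
    by (auto intro!: linearI simp: vec_eq_iff algebra_simps)
  then show ?thesis by (simp add: bilinear_conv_bounded_bilinear)
qed

lemma bounded_linear_mat_entry:
  "bounded_linear (\<lambda>A :: complex^'n^'n. A $ i $ j)"
  by (intro bounded_linear_compose[OF bounded_linear_vec_nth bounded_linear_vec_nth])

lemma mat_tendstoI:
  fixes F :: "'a \<Rightarrow> complex^'n^'n"
  assumes "\<And>i j. ((\<lambda>x. F x $ i $ j) \<longlongrightarrow> A $ i $ j) net"
  shows "(F \<longlongrightarrow> A) net"
  by (intro vec_tendstoI assms)

lemmas tendsto_matrix_matrix_mult = bounded_bilinear.tendsto[OF bounded_bilinear_matrix_matrix_mult]
lemmas tendsto_smult_mat = bounded_bilinear.tendsto[OF bounded_bilinear_smult_mat]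

lemma has_vector_derivative_matI:
  fixes F :: "real \<Rightarrow> complex^'n^'n"
  assumes "\<And>i j. ((\<lambda>t. F t $ i $ j) has_vector_derivative A $ i $ j) (at x)"
  shows "(F has_vector_derivative A) (at x)"
  using assms unfolding has_vector_derivative_def has_derivative_def
  by (auto intro!: mat_tendstoI bounded_linear_scaleR_left)

section \<open>Scalar expansions at infinity: leading coefficients and decay of the
  \<open>l\<close>-derivative\<close>

text \<open>After the factor \<open>l powi (int j - d)\<close> and removal of the vanishing terms,
  the expansion is a power series in \<open>1/l\<close> with constant term \<open>c j\<close>, and a
  convergent power series tends to its constant term at 0. Comparison of coefficients is thereby
  reduced to uniqueness of limits.\<close>

lemma tendsto_lead_coeff:
  fixes c :: "nat \<Rightarrow> complex"
  assumes "\<forall>\<^sub>F l in at_infinity. (\<lambda>k. c k * l powi (d - int k)) sums F l"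
    and z: "\<And>i. i < j \<Longrightarrow> c i = 0"
  shows "((\<lambda>l. l powi (int j - d) * F l) \<longlongrightarrow> c j) at_infinity"
proof -
  obtain B where B: "\<And>l. B \<le> norm l \<Longrightarrow> (\<lambda>k. c k * l powi (d - int k)) sums F l"
    using assms(1) by (auto simp: eventually_at_infinity)
  \<comment> \<open>The maximum with 1 keeps the radius positive whatever the sign of
    \<open>B\<close>.\<close>
  define s where "s = inverse (max B 1)"
  have "s > 0" by (simp add: s_def)
  have "(((\<lambda>l. l powi (int j - d) * F l) \<circ> inverse) \<longlongrightarrow> c (0 + j)) (at 0)"
  proof (rule powser_limit_0_strong[OF \<open>s > 0\<close>])
    fix z :: complex assume "z \<noteq> 0" "norm z < s"
    define l where "l = inverse z"
    have "l \<noteq> 0" "B \<le> norm l" using \<open>z \<noteq> 0\<close> \<open>norm z < s\<close>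
      unfolding l_def s_def norm_inverse
      by (auto, smt (verit) inverse_inverse_eq le_imp_inverse_le norm_inverse zero_less_norm_iff)
    have e: "l powi (int j - d) * (c k * l powi (d - int k)) = c k * l powi (int j - int k)" for k
      using \<open>l \<noteq> 0\<close> by (simp add: power_int_add[symmetric] mult.left_commute)
    have "(\<lambda>k. c k * l powi (int j - int k)) sums (l powi (int j - d) * F l)"
      using sums_mult[OF B[OF \<open>B \<le> norm l\<close>], of "l powi (int j - d)"] unfolding e .
    then have "(\<lambda>k. c (k + j) * l powi (int j - int (k + j))) sums (l powi (int j - d) * F l)"
      by (subst sums_zero_iff_shift) (auto simp: z)
    moreover have "l powi (int j - int (k + j)) = z ^ k" for k
      by (simp add: l_def power_int_minus power_int_def power_inverse)
    ultimately show "(\<lambda>k. c (k + j) * z ^ k) sums ((\<lambda>l. l powi (int j - d) * F l) \<circ> inverse) z"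
      by (simp add: l_def)
  qed
  then show ?thesis by (simp add: lim_at_infinity_0 o_def)
qed

text \<open>With \<open>z = 1/l\<close> the function is \<open>g z\<close> for a power series
  \<open>g\<close>, so by the chain rule its derivative times the square of \<open>l\<close> is
  \<open>- deriv g (1/l)\<close>, which tends to \<open>- deriv g 0\<close>. This gain of two powers
  of \<open>l\<close> is the source of the 2 in the degree hypotheses.\<close>

lemma tendsto_deriv_at_infinity:
  fixes c :: "nat \<Rightarrow> complex"
  assumes "\<forall>\<^sub>F l in at_infinity. (\<lambda>k. c k * l powi (- int k)) sums F l"
  shows "\<exists>d. ((\<lambda>l. l\<^sup>2 * deriv F l) \<longlongrightarrow> d) at_infinity"
proof -
  obtain B where B: "\<And>l. B \<le> norm l \<Longrightarrow> (\<lambda>k. c k * l powi (- int k)) sums F l"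
    using assms(1) by (auto simp: eventually_at_infinity)
  define R where "R = max B 1"
  define g where "g z = (\<Sum>k. c k * z ^ k)" for z
  have "R > 0" by (simp add: R_def)
  have s: "(\<lambda>k. c k * z ^ k) sums F (inverse z)" if "z \<noteq> 0" "norm z < inverse R" for z
  proof -
    have "B \<le> norm (inverse z)" using that unfolding R_def norm_inverse
      by (smt (verit) inverse_inverse_eq le_imp_inverse_le norm_inverse zero_less_norm_iff)
    from B[OF this] show ?thesis by (simp add: power_int_minus power_inverse)
  qed
  have "g holomorphic_on ball 0 (inverse R)"
  proof (rule power_series_holomorphic)
    fix w :: complex assume w: "w \<in> ball 0 (inverse R)"
    show "(\<lambda>n. c n * (w - 0) ^ n) sums g w"
    proof (cases "w = 0")
      case True then show ?thesis unfolding g_def by (simp add: powser_sums_zero)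
    next
      case False then show ?thesis unfolding g_def using s[of w] w by (simp add: sums_iff)
    qed
  qed
  then have hg: "g field_differentiable (at z)" "isCont (deriv g) z" if "norm z < inverse R" for z
    using that holomorphic_deriv[of g "ball 0 (inverse R)"]
    by (auto simp: holomorphic_on_open field_differentiable_def intro: DERIV_isCont)
  have "((\<lambda>l. - deriv g (inverse l)) \<longlongrightarrow> - deriv g 0) at_infinity"
    using hg(2)[of 0] \<open>R > 0\<close>
    by (auto simp: lim_at_infinity_0 o_def isCont_def intro!: tendsto_minus)
  moreover have "\<forall>\<^sub>F l in at_infinity. - deriv g (inverse l) = l\<^sup>2 * deriv F l"
    unfolding eventually_at_infinity
  proof (intro exI allI impI)
    \<comment> \<open>The extra 1 makes the bound strict: \<open>{m. R < norm m}\<close> is open, so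
      the derivative can be transferred from \<open>g (inverse m)\<close> to \<open>F\<close> on
      it.\<close>
    fix l :: complex assume "R + 1 \<le> norm l"
    then have l: "R < norm l" by simp
    then have "l \<noteq> 0" using \<open>R > 0\<close> by auto
    have n: "norm (inverse m) < inverse R" if "R < norm m" for m :: complex
      using that \<open>R > 0\<close> by (simp add: norm_inverse less_imp_inverse_less)
    have F: "g (inverse m) = F m" if "R < norm m" for m
      using s[of "inverse m"] n[OF that] that \<open>R > 0\<close> unfolding g_def by (cases "m = 0") (auto simp: sums_iff)
    have "((\<lambda>m. g (inverse m)) has_field_derivative deriv g (inverse l) * (- inverse (l\<^sup>2))) (at l)"
      using hg(1)[OF n[OF l]] \<open>l \<noteq> 0\<close>
      by (intro DERIV_chain2[where f=g])
         (auto simp: field_differentiable_derivI power2_eq_square intro!: derivative_eq_intros)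
    then have "(F has_field_derivative deriv g (inverse l) * (- inverse (l\<^sup>2))) (at l)"
      by (rule has_field_derivative_transform_within_open[where S="{m. R < norm m}"])
         (auto simp: l F intro!: open_Collect_less continuous_intros)
    then show "- deriv g (inverse l) = l\<^sup>2 * deriv F l"
      using \<open>l \<noteq> 0\<close> by (simp add: DERIV_imp_deriv)
  qed
  ultimately show ?thesis by (auto dest: Lim_transform_eventually)
qed

section \<open>Interchange of a parameter derivative with the limit at infinity\<close>

text \<open>The limit in \<open>lim\<close> is only pointwise in \<open>s\<close>, and nothing is
  assumed on the growth of \<open>g\<close> near infinity. Holomorphy compensates for this: Cauchy's
  formula expresses the values near infinity, and the limit \<open>\<tau> s\<close> itself, by
  values of \<open>f s\<close> on a fixed circle, where differentiation under the integral sign is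
  legitimate.\<close>

lemma has_vector_derivative_limit_at_infinity:
  fixes f g :: "real \<Rightarrow> complex \<Rightarrow> complex" and \<tau> :: "real \<Rightarrow> complex"
  assumes S: "open S" "convex S" "t \<in> S" and "R > 0"
    and hol: "\<And>s l. s \<in> S \<Longrightarrow> R < norm l \<Longrightarrow> f s field_differentiable at l"
    and der: "\<And>s l. s \<in> S \<Longrightarrow> R < norm l \<Longrightarrow> ((\<lambda>s. f s l) has_vector_derivative g s l) (at s)"
    and cont: "continuous_on (S \<times> {l. R < norm l}) (\<lambda>(s, l). g s l)"
    and lim: "\<And>s. s \<in> S \<Longrightarrow> (f s \<longlongrightarrow> \<tau> s) at_infinity"
  shows "\<exists>d. (\<tau> has_vector_derivative d) (at t) \<and> (g t \<longlongrightarrow> d) at_infinity"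
proof -
  \<comment> \<open>Any radius below \<open>inverse R\<close> would serve; the closed disc then lies
    where \<open>f s (inverse z)\<close> is holomorphic apart from 0.\<close>
  define r where "r = inverse (2 * R)"
  have "r > 0" using \<open>R > 0\<close> by (simp add: r_def)
  \<comment> \<open>The coordinate \<open>z = 1/l\<close> moves infinity to 0. The value
    \<open>\<tau> s\<close> there makes \<open>E s\<close> continuous at 0, so the singularity is
    removable.\<close>
  define E where "E s z = (if z = 0 then \<tau> s else f s (inverse z))" for s z
  have large: "R < norm (inverse z)" if "z \<noteq> 0" "norm z < inverse R" for z :: complex
    using less_imp_inverse_less[OF that(2)] that(1) by (simp add: norm_inverse)
  have holE: "E s holomorphic_on cball 0 r" if "s \<in> S" for s
  proof -
    have "E s holomorphic_on ball 0 (inverse R)"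
    proof (rule no_isolated_singularity'[where K = "{0}"])
      fix z :: complex assume "z \<in> {0}"
      have "((f s \<circ> inverse) \<longlongrightarrow> \<tau> s) (at 0)"
        using lim[OF that] by (simp add: lim_at_infinity_0)
      then have "(E s \<longlongrightarrow> \<tau> s) (at 0)"
        by (rule Lim_transform_eventually) (auto simp: E_def eventually_at intro!: exI[of _ 1])
      then show "(E s \<longlongrightarrow> E s z) (at z within ball 0 (inverse R))"
        using \<open>z \<in> {0}\<close> by (auto simp: E_def intro: tendsto_within_subset)
    next
      have "(\<lambda>z. f s (inverse z)) holomorphic_on ball 0 (inverse R) - {0}"
      proof (subst holomorphic_on_open)
        show "\<forall>z\<in>ball 0 (inverse R) - {0}. \<exists>d. ((\<lambda>z. f s (inverse z)) has_field_derivative d) (at z)"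
        proof
          fix z :: complex assume z: "z \<in> ball 0 (inverse R) - {0}"
          then obtain d where "(f s has_field_derivative d) (at (inverse z))"
            using hol[OF \<open>s \<in> S\<close> large[of z]] by (auto simp: field_differentiable_def)
          then show "\<exists>d. ((\<lambda>z. f s (inverse z)) has_field_derivative d) (at z)"
            using z by (auto intro!: exI DERIV_chain2[where f="f s"] derivative_eq_intros)
        qed
      qed auto
      then show "E s holomorphic_on ball 0 (inverse R) - {0}"
        by (rule holomorphic_transform) (auto simp: E_def)
    qed auto
    then show ?thesis
      by (rule holomorphic_on_subset) (use \<open>R > 0\<close> in \<open>auto simp: r_def\<close>, simp add: field_simps)
  qed
  define p where "p \<theta> = circlepath 0 r \<theta>" for \<theta>
  have p: "norm (p \<theta>) = r" "p \<theta> \<noteq> 0" "R < norm (inverse (p \<theta>))" for \<theta>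
  proof -
    show n: "norm (p \<theta>) = r" using \<open>r > 0\<close> by (simp add: p_def circlepath norm_mult)
    then show "p \<theta> \<noteq> 0" using \<open>r > 0\<close> by auto
    show "R < norm (inverse (p \<theta>))" using \<open>R > 0\<close> unfolding norm_inverse n r_def by (simp add: field_simps)
  qed
  have contp: "continuous_on X p" for X
    unfolding p_def circlepath by (intro continuous_intros)
  \<comment> \<open>The Cauchy kernel on the parametrised circle: the derivative of \<open>p\<close>
    is \<open>2 * pi * \<i>\<close> times \<open>p\<close>, which cancels the constant in Cauchy's
    formula and leaves \<open>p\<close> in the numerator.\<close>
  define \<kappa> where "\<kappa> z \<theta> = p \<theta> / (p \<theta> - z)" for z \<theta>
  have ne: "p \<theta> - z \<noteq> 0" if "norm z < r" for z \<theta> using p(1)[of \<theta>] that by auto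
  have cauchy: "((\<lambda>\<theta>. f s (inverse (p \<theta>)) * \<kappa> z \<theta>) has_integral E s z) {0..1}"
    if "s \<in> S" "norm z < r" for s z
  proof -
    have "((\<lambda>u. E s u / (u - z)) has_contour_integral (2 * of_real pi * \<i> * E s z)) (circlepath 0 r)"
      using holE[OF that(1)] that(2) by (intro Cauchy_integral_circlepath_simple) auto
    then have "((\<lambda>\<theta>. 2 * of_real pi * \<i> * (f s (inverse (p \<theta>)) * \<kappa> z \<theta>)) has_integral
        (2 * of_real pi * \<i> * E s z)) {0..1}"
      unfolding has_contour_integral
    proof (rule has_integral_eq[rotated])
      fix \<theta> :: real
      show "E s (circlepath 0 r \<theta>) / (circlepath 0 r \<theta> - z) * vector_derivative (circlepath 0 r) (at \<theta>) =
          2 * of_real pi * \<i> * (f s (inverse (p \<theta>)) * \<kappa> z \<theta>)"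
        using p(2)[of \<theta>] unfolding vector_derivative_circlepath \<kappa>_def p_def[symmetric]
        by (simp add: E_def) (simp add: p_def circlepath)
    qed
    from has_integral_mult_right[OF this, of "inverse (2 * of_real pi * \<i>)"]
    show ?thesis by (simp add: field_simps)
  qed
  \<comment> \<open>\<open>d z\<close> is to be the derivative of \<open>E s z\<close> at
    \<open>s = t\<close>. At \<open>z = 0\<close> it is the derivative of \<open>\<tau>\<close>; for
    small \<open>z\<close> other than 0 it equals \<open>g t (inverse z)\<close> by uniqueness of
    derivatives. Continuity of \<open>d\<close> at 0 joins the two.\<close>
  define d where "d z = integral {0..1} (\<lambda>\<theta>. g t (inverse (p \<theta>)) * \<kappa> z \<theta>)" for z
  have contg: "continuous_on (X \<times> Y) (\<lambda>(s, \<theta>). g s (inverse (p \<theta>)))" if "X \<subseteq> S" for X Y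
  proof -
    have "continuous_on (X \<times> Y) (\<lambda>w. (\<lambda>(s, l). g s l) (fst w, inverse (p (snd w))))"
      by (rule continuous_on_compose2[OF cont])
         (use that p in \<open>auto intro!: continuous_intros continuous_on_compose2[OF contp[of UNIV]]\<close>)
    then show ?thesis by (simp add: case_prod_unfold)
  qed
  have derE: "((\<lambda>s. E s z) has_vector_derivative d z) (at t)" if z: "norm z < r" for z
  proof -
    have "((\<lambda>s. integral (cbox 0 1) (\<lambda>\<theta>. f s (inverse (p \<theta>)) * \<kappa> z \<theta>)) has_vector_derivative
       integral (cbox 0 1) (\<lambda>\<theta>. g t (inverse (p \<theta>)) * \<kappa> z \<theta>)) (at t within S)"
    proof (rule leibniz_rule_vector_derivative)
      fix s and \<theta> :: real assume "s \<in> S"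
      show "((\<lambda>s. f s (inverse (p \<theta>)) * \<kappa> z \<theta>) has_vector_derivative
          g s (inverse (p \<theta>)) * \<kappa> z \<theta>) (at s within S)"
        by (intro has_vector_derivative_mult_left has_vector_derivative_at_within[OF der] \<open>s \<in> S\<close> p)
    next
      fix s assume "s \<in> S"
      show "(\<lambda>\<theta>. f s (inverse (p \<theta>)) * \<kappa> z \<theta>) integrable_on cbox 0 1"
        using cauchy[OF \<open>s \<in> S\<close> z] by (auto simp: integrable_on_def)
    next
      show "continuous_on (S \<times> cbox 0 1) (\<lambda>(s, \<theta>). g s (inverse (p \<theta>)) * \<kappa> z \<theta>)"
        using contg[of S "cbox 0 1"] ne[OF z] unfolding case_prod_unfold \<kappa>_def
        by (intro continuous_intros continuous_on_compose2[OF contp[of UNIV]]) auto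
    qed (use S in auto)
    then have "((\<lambda>s. integral {0..1} (\<lambda>\<theta>. f s (inverse (p \<theta>)) * \<kappa> z \<theta>)) has_vector_derivative d z) (at t)"
      using S by (simp add: d_def at_within_open[OF S(3,1)])
    then show ?thesis
      by (rule has_vector_derivative_transform_within_open[OF _ S(1,3)])
         (use cauchy[OF _ z] in \<open>auto intro: integral_unique\<close>)
  qed
  have "continuous_on (ball 0 r) (\<lambda>z. integral (cbox 0 1) (\<lambda>\<theta>. g t (inverse (p \<theta>)) * \<kappa> z \<theta>))"
  proof (rule integral_continuous_on_param)
    have "continuous_on (ball 0 r \<times> cbox 0 1) (\<lambda>w. (\<lambda>(s, \<theta>). g s (inverse (p \<theta>))) (t, snd w))"
      by (rule continuous_on_compose2[OF contg[of "{t}" UNIV]]) (use S in \<open>auto intro!: continuous_intros\<close>)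
    then show "continuous_on (ball 0 r \<times> cbox 0 1) (\<lambda>(z, \<theta>). g t (inverse (p \<theta>)) * \<kappa> z \<theta>)"
      using ne unfolding case_prod_unfold \<kappa>_def
      by (intro continuous_intros continuous_on_compose2[OF contp[of UNIV]]) auto
  qed
  then have "isCont d 0"
    using \<open>r > 0\<close> unfolding d_def by (auto simp: continuous_on_eq_continuous_at)
  then have "(d \<longlongrightarrow> d 0) (at 0)" by (simp add: isCont_def)
  moreover have "\<forall>\<^sub>F z in at 0. d z = (g t \<circ> inverse) z"
    unfolding eventually_at
  proof (intro exI conjI ballI impI)
    fix z :: complex assume "z \<noteq> 0 \<and> dist z 0 < r"
    then have z: "z \<noteq> 0" "norm z < r" by auto
    have "norm z < inverse R" using z(2) \<open>R > 0\<close> by (simp add: r_def field_simps)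
    from der[OF S(3) large[OF z(1) this]] derE[OF z(2)] z(1)
    show "d z = (g t \<circ> inverse) z"
      by (simp add: E_def vector_derivative_unique_at)
  qed (fact \<open>r > 0\<close>)
  ultimately have "(g t \<longlongrightarrow> d 0) at_infinity"
    by (simp add: lim_at_infinity_0 Lim_transform_eventually)
  moreover have "(\<tau> has_vector_derivative d 0) (at t)"
    using derE[of 0] \<open>r > 0\<close> by (simp add: E_def)
  ultimately show ?thesis by blast
qed

section \<open>Matrix inverses and closure properties of the Lie algebra of a matrix group\<close>

lemma matrix_inv_cancel:
  fixes A :: "complex^'n^'n"
  assumes "invertible A"
  shows "A ** matrix_inv A = mat 1" "matrix_inv A ** A = mat 1"
proof -
  have "A ** matrix_inv A = mat 1 \<and> matrix_inv A ** A = mat 1"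
    unfolding matrix_inv_def using assms[unfolded invertible_def] by (rule someI_ex)
  then show "A ** matrix_inv A = mat 1" "matrix_inv A ** A = mat 1" by auto
qed

lemmas has_vector_derivative_matrix_matrix_mult =
  bounded_bilinear.has_vector_derivative[OF bounded_bilinear_matrix_matrix_mult]

lemma differentiable_matrix_matrix_mult:
  fixes f g :: "real \<Rightarrow> complex^'n^'n"
  assumes "f differentiable at t" "g differentiable at t"
  shows "(\<lambda>t. f t ** g t) differentiable at t"
  using has_vector_derivative_matrix_matrix_mult[OF assms[unfolded vector_derivative_works]]
  by (rule differentiableI_vector)

text \<open>The pointwise product of the two curves has velocity \<open>A + B\<close> at 0, by the
  product rule and since both curves start at the identity.\<close>

lemma lie_algebra_add:
  fixes G :: "(complex^'n^'n) set"
  assumes G: "matrix_lie_group G" and "A \<in> lie_algebra G" "B \<in> lie_algebra G"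
  shows "A + B \<in> lie_algebra G"
proof -
  obtain \<gamma> \<delta> :: "real \<Rightarrow> complex^'n^'n" and e1 e2 where e: "e1 > 0" "e2 > 0"
    and \<gamma>: "\<gamma> 0 = mat 1" "\<And>t. t \<in> {-e1<..<e1} \<Longrightarrow> \<gamma> t \<in> G \<and> \<gamma> differentiable at t"
       "(\<gamma> has_vector_derivative A) (at 0)"
    and \<delta>: "\<delta> 0 = mat 1" "\<And>t. t \<in> {-e2<..<e2} \<Longrightarrow> \<delta> t \<in> G \<and> \<delta> differentiable at t"
       "(\<delta> has_vector_derivative B) (at 0)"
    using assms(2,3) unfolding lie_algebra_def by blast
  show ?thesis unfolding lie_algebra_def
  proof (intro CollectI exI conjI ballI)
    show "min e1 e2 > 0" using e by simp
    show "\<gamma> 0 ** \<delta> 0 = mat 1" using \<gamma> \<delta> by simp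
    show "((\<lambda>t. \<gamma> t ** \<delta> t) has_vector_derivative A + B) (at 0)"
      using has_vector_derivative_matrix_matrix_mult[OF \<gamma>(3) \<delta>(3)] \<gamma>(1) \<delta>(1)
      by (simp add: add.commute)
  next
    fix t assume "t \<in> {-min e1 e2<..<min e1 e2}"
    then have t: "t \<in> {-e1<..<e1}" "t \<in> {-e2<..<e2}" by auto
    show "\<gamma> t ** \<delta> t \<in> G"
      using G \<gamma>(2)[OF t(1)] \<delta>(2)[OF t(2)] by (simp add: matrix_lie_group_def)
    show "(\<lambda>t. \<gamma> t ** \<delta> t) differentiable at t"
      using \<gamma>(2)[OF t(1)] \<delta>(2)[OF t(2)] by (simp add: differentiable_matrix_matrix_mult)
  qed
qed

text \<open>Conjugating a curve through the identity by \<open>P\<close> gives another such curve in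
  the group, with conjugated velocity.\<close>

lemma lie_algebra_conjugate:
  fixes G :: "(complex^'n^'n) set"
  assumes G: "matrix_lie_group G" and A: "A \<in> lie_algebra G" and P: "P \<in> G"
  shows "P ** A ** matrix_inv P \<in> lie_algebra G"
proof -
  obtain \<gamma> :: "real \<Rightarrow> complex^'n^'n" and e where e: "e > 0"
    and \<gamma>: "\<gamma> 0 = mat 1" "\<And>t. t \<in> {-e<..<e} \<Longrightarrow> \<gamma> t \<in> G \<and> \<gamma> differentiable at t"
       "(\<gamma> has_vector_derivative A) (at 0)"
    using A unfolding lie_algebra_def by blast
  have inv: "P ** matrix_inv P = mat 1"
    using G P by (auto simp: matrix_lie_group_def intro: matrix_inv_cancel)
  show ?thesis unfolding lie_algebra_def
  proof (intro CollectI exI conjI ballI)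
    show "P ** \<gamma> 0 ** matrix_inv P = mat 1" using \<gamma> inv by simp
    have "((\<lambda>t. P ** \<gamma> t) has_vector_derivative P ** A) (at 0)"
      using has_vector_derivative_matrix_matrix_mult[OF has_vector_derivative_const \<gamma>(3)]
      by (simp add: bounded_bilinear.zero_left[OF bounded_bilinear_matrix_matrix_mult])
    then show "((\<lambda>t. P ** \<gamma> t ** matrix_inv P) has_vector_derivative P ** A ** matrix_inv P) (at 0)"
      using has_vector_derivative_matrix_matrix_mult[OF _ has_vector_derivative_const]
      by (fastforce simp: bounded_bilinear.zero_right[OF bounded_bilinear_matrix_matrix_mult])
  next
    fix t assume t: "t \<in> {-e<..<e}"
    show "P ** \<gamma> t ** matrix_inv P \<in> G"
      using G \<gamma>(2)[OF t] P by (simp add: matrix_lie_group_def)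
    show "(\<lambda>t. P ** \<gamma> t ** matrix_inv P) differentiable at t"
      using \<gamma>(2)[OF t] by (intro differentiable_matrix_matrix_mult) auto
  qed fact
qed

text \<open>Translating the curve back to the identity, as
  \<open>f (t + s) ** matrix_inv (f t)\<close>, gives a curve with the required velocity at
  \<open>s = 0\<close>. It is meant for \<open>T 0\<close> along the first coordinate.\<close>

lemma lie_algebra_logarithmic_derivative:
  fixes G :: "(complex^'n^'n) set" and f :: "real \<Rightarrow> complex^'n^'n"
  assumes G: "matrix_lie_group G" and e: "e > 0"
    and f: "\<And>s. s \<in> ball t e \<Longrightarrow> f s \<in> G \<and> f differentiable at s"
    and A: "(f has_vector_derivative A) (at t)"
  shows "A ** matrix_inv (f t) \<in> lie_algebra G"
proof -
  have ft: "f t \<in> G" using f e by simp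
  have inv: "f t ** matrix_inv (f t) = mat 1"
    using G ft by (auto simp: matrix_lie_group_def intro: matrix_inv_cancel)
  have sh: "((\<lambda>s. t + s) has_vector_derivative 1) (at s)" for s :: real
    by (auto intro!: derivative_eq_intros)
  show ?thesis unfolding lie_algebra_def
  proof (intro CollectI exI conjI ballI)
    show "f (t + 0) ** matrix_inv (f t) = mat 1" using inv by simp
    have "((\<lambda>s. f (t + s)) has_vector_derivative A) (at 0)"
      using vector_diff_chain_at[OF sh[of 0], of f A] A by (simp add: o_def)
    then show "((\<lambda>s. f (t + s) ** matrix_inv (f t)) has_vector_derivative A ** matrix_inv (f t)) (at 0)"
      using has_vector_derivative_matrix_matrix_mult[OF _ has_vector_derivative_const]
      by (fastforce simp: bounded_bilinear.zero_right[OF bounded_bilinear_matrix_matrix_mult])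
  next
    fix s assume "s \<in> {-e<..<e}"
    then have s: "t + s \<in> ball t e" by (auto simp: dist_real_def)
    show "f (t + s) ** matrix_inv (f t) \<in> G"
      using G f[OF s] ft by (simp add: matrix_lie_group_def)
    have "(\<lambda>s. f (t + s)) differentiable at s"
      using differentiableI_vector[OF vector_diff_chain_at[OF sh, of f]] f[OF s]
      unfolding vector_derivative_works[of f] o_def by blast
    then show "(\<lambda>s. f (t + s) ** matrix_inv (f t)) differentiable at s"
      by (intro differentiable_matrix_matrix_mult) auto
  qed fact
qed

section \<open>Matrix expansions at infinity and their derivatives in \<open>x\<close> and
  \<open>l\<close>\<close>

lemma tendsto_lead_coeff_mat:
  fixes c :: "nat \<Rightarrow> complex^'n^'n"
  assumes F: "\<forall>\<^sub>F l in at_infinity. (\<lambda>k. (l powi (d - int k)) *\<^sub>M c k) sums F l"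
    and z: "\<And>i. i < j \<Longrightarrow> c i = 0"
  shows "((\<lambda>l. (l powi (int j - d)) *\<^sub>M F l) \<longlongrightarrow> c j) at_infinity"
proof (rule mat_tendstoI)
  fix p q
  have "\<forall>\<^sub>F l in at_infinity. (\<lambda>k. c k $ p $ q * l powi (d - int k)) sums (F l $ p $ q)"
    using F by eventually_elim (drule bounded_linear.sums[OF bounded_linear_mat_entry[of p q]], simp add: mult.commute)
  then show "((\<lambda>l. ((l powi (int j - d)) *\<^sub>M F l) $ p $ q) \<longlongrightarrow> c j $ p $ q) at_infinity"
    using tendsto_lead_coeff[of "\<lambda>k. c k $ p $ q" d "\<lambda>l. F l $ p $ q" j] z by simp
qed

lemma tendsto_dlam_at_infinity:
  fixes D :: "real \<times> real \<Rightarrow> complex \<Rightarrow> complex^'n^'n"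
  assumes "mat_expansion \<Omega> 0 T D" "x \<in> \<Omega>"
  shows "\<exists>A. ((\<lambda>l. l\<^sup>2 *\<^sub>M dlam D x l) \<longlongrightarrow> A) at_infinity"
proof -
  have "\<exists>a. ((\<lambda>l. l\<^sup>2 * deriv (\<lambda>m. D x m $ p $ q) l) \<longlongrightarrow> a) at_infinity" for p q
  proof (rule tendsto_deriv_at_infinity)
    have "\<forall>\<^sub>F l in at_infinity. (\<lambda>k. (l powi (0 - int k)) *\<^sub>M T k x) sums D x l"
      using assms by (simp add: mat_expansion_def)
    then show "\<forall>\<^sub>F l in at_infinity. (\<lambda>k. T k x $ p $ q * l powi (- int k)) sums (D x l $ p $ q)"
      by eventually_elim (drule bounded_linear.sums[OF bounded_linear_mat_entry[of p q]], simp add: mult.commute)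
  qed
  then obtain a where "\<And>p q. ((\<lambda>l. l\<^sup>2 * deriv (\<lambda>m. D x m $ p $ q) l) \<longlongrightarrow> a p q) at_infinity"
    by metis
  then have "((\<lambda>l. l\<^sup>2 *\<^sub>M dlam D x l) \<longlongrightarrow> (\<chi> p q. a p q)) at_infinity"
    by (intro mat_tendstoI) (simp add: dlam_def)
  then show ?thesis by blast
qed

text \<open>The curve \<open>c\<close> stands for a coordinate line through a point, so that both
  partial derivatives of \<open>D\<close> are covered at once. The scalar interchange result is
  applied to each matrix entry along the curve.\<close>

lemma leading_coeff_derivative:
  fixes D D' :: "real \<times> real \<Rightarrow> complex \<Rightarrow> complex^'n^'n" and c :: "real \<Rightarrow> real \<times> real"
  assumes \<Omega>: "open \<Omega>" "c t \<in> \<Omega>" and c: "continuous_on UNIV c"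
    and D: "mat_expansion \<Omega> 0 T D"
    and ev: "\<forall>\<^sub>F (x, l) in nhds (c t) \<times>\<^sub>F at_infinity.
      (\<forall>i j. (\<lambda>m. D x m $ i $ j) field_differentiable at l) \<and>
      (\<forall>s. x = c s \<longrightarrow> ((\<lambda>s. D (c s) l) has_vector_derivative D' x l) (at s)) \<and>
      isCont (\<lambda>(y, m). D' y m) (x, l)"
  shows "\<exists>A. ((\<lambda>s. T 0 (c s)) has_vector_derivative A) (at t) \<and> (D' (c t) \<longlongrightarrow> A) at_infinity"
proof -
  define good where "good x l \<longleftrightarrow> (\<forall>i j. (\<lambda>m. D x m $ i $ j) field_differentiable at l) \<and>
      (\<forall>s. x = c s \<longrightarrow> ((\<lambda>s. D (c s) l) has_vector_derivative D' x l) (at s)) \<and>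
      isCont (\<lambda>(y, m). D' y m) (x, l)" for x l
  have "\<forall>\<^sub>F (x, l) in nhds (c t) \<times>\<^sub>F at_infinity. good x l"
    using ev by (simp only: good_def)
  \<comment> \<open>The product filter supplies one bound on \<open>norm l\<close> valid on a whole
    neighbourhood of \<open>c t\<close>. This local uniformity in \<open>x\<close> yields the
    product domain on which Cauchy's formula is differentiated.\<close>
  then obtain P Q where "eventually P (nhds (c t))" "eventually Q at_infinity"
    and PQ: "\<And>x l. P x \<Longrightarrow> Q l \<Longrightarrow> good x l"
    unfolding eventually_prod_filter split_conv by blast
  then obtain X R where X: "open X" "c t \<in> X" "\<And>x. x \<in> X \<Longrightarrow> P x"
    and R: "\<And>l. R \<le> norm l \<Longrightarrow> Q l"
    unfolding eventually_nhds eventually_at_infinity by blast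
  have "open (c -` (X \<inter> \<Omega>))"
    using c X(1) \<Omega>(1) by (intro open_vimage) auto
  moreover have "t \<in> c -` (X \<inter> \<Omega>)" using X(2) \<Omega>(2) by simp
  ultimately obtain e where e: "e > 0" "ball t e \<subseteq> c -` (X \<inter> \<Omega>)" by (rule openE)
  then have cs: "P (c s)" "c s \<in> \<Omega>" if "s \<in> ball t e" for s
    using that X(3) by auto
  have "\<exists>a. ((\<lambda>s. T 0 (c s) $ i $ j) has_vector_derivative a) (at t) \<and>
      ((\<lambda>l. D' (c t) l $ i $ j) \<longlongrightarrow> a) at_infinity" for i j
  proof (rule has_vector_derivative_limit_at_infinity[where f = "\<lambda>s l. D (c s) l $ i $ j"
        and g = "\<lambda>s l. D' (c s) l $ i $ j" and S = "ball t e" and R = "max R 1"])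
    fix s and l :: complex assume s: "s \<in> ball t e" and l: "max R 1 < norm l"
    have "Q l" using l R by simp
    note * = PQ[OF cs(1)[OF s] this, unfolded good_def]
    show "(\<lambda>m. D (c s) m $ i $ j) field_differentiable at l" using * by blast
    have "((\<lambda>s. D (c s) l) has_vector_derivative D' (c s) l) (at s)" using * by blast
    then show "((\<lambda>s. D (c s) l $ i $ j) has_vector_derivative D' (c s) l $ i $ j) (at s)"
      by (rule bounded_linear.has_vector_derivative[OF bounded_linear_mat_entry])
  next
    have "isCont (\<lambda>w. D' (c (fst w)) (snd w) $ i $ j) (s, l)"
      if s: "s \<in> ball t e" and l: "max R 1 < norm l" for s l
    proof -
      have "Q l" using l R by simp
      then have D': "isCont (\<lambda>(y, m). D' y m) (c s, l)"
        using PQ[OF cs(1)[OF s]] unfolding good_def by blast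
      have "isCont c s" using c by (simp add: continuous_on_eq_continuous_at)
      then have "isCont (\<lambda>w :: real \<times> complex. c (fst w)) (s, l)"
        by (intro isCont_o2[of "(s, l)" fst c]) (simp_all only: fst_conv isCont_fst[OF continuous_ident])
      then have "isCont (\<lambda>w. (c (fst w), snd w)) (s, l)"
        by (rule isCont_Pair[OF _ isCont_snd[OF continuous_ident]])
      then have "isCont (\<lambda>w. (\<lambda>(y, m). D' y m) (c (fst w), snd w)) (s, l)"
        by (rule isCont_o2) (simp only: fst_conv snd_conv D')
      then have "isCont (\<lambda>w. D' (c (fst w)) (snd w)) (s, l)"
        by (simp only: split_conv)
      then show ?thesis by (rule isCont_vec_nth[OF isCont_vec_nth])
    qed
    then have "\<forall>w\<in>ball t e \<times> {l. max R 1 < norm l}. isCont (\<lambda>w. D' (c (fst w)) (snd w) $ i $ j) w"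
      by blast
    then show "continuous_on (ball t e \<times> {l. max R 1 < norm l}) (\<lambda>(s, l). D' (c s) l $ i $ j)"
      unfolding case_prod_unfold by (rule continuous_at_imp_continuous_on)
  next
    fix s assume "s \<in> ball t e"
    then have "\<forall>\<^sub>F l in at_infinity. (\<lambda>k. (l powi (0 - int k)) *\<^sub>M T k (c s)) sums D (c s) l"
      using D cs(2) by (simp add: mat_expansion_def)
    from tendsto_lead_coeff_mat[OF this, of 0]
    have "(D (c s) \<longlongrightarrow> T 0 (c s)) at_infinity" by simp
    then show "((\<lambda>l. D (c s) l $ i $ j) \<longlongrightarrow> T 0 (c s) $ i $ j) at_infinity"
      by (rule bounded_linear.tendsto[OF bounded_linear_mat_entry])
  qed (use e in auto)
  then obtain a where a: "\<And>i j. ((\<lambda>s. T 0 (c s) $ i $ j) has_vector_derivative a i j) (at t) \<and>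
      ((\<lambda>l. D' (c t) l $ i $ j) \<longlongrightarrow> a i j) at_infinity"
    by metis
  have "((\<lambda>s. T 0 (c s)) has_vector_derivative (\<chi> i j. a i j)) (at t)"
    by (rule has_vector_derivative_matI) (simp add: a)
  moreover have "(D' (c t) \<longlongrightarrow> (\<chi> i j. a i j)) at_infinity"
    by (rule mat_tendstoI) (simp add: a)
  ultimately show ?thesis by blast
qed

section \<open>The combination \<open>U + H V\<close> and comparison of leading coefficients under
  the transformation\<close>

text \<open>The factor \<open>l powi (int N - int M - int i)\<close> brings the expansion of
  \<open>V\<close> to degree \<open>N\<close> and shifts its index by \<open>i\<close>; only
  finitely many shifted series are added. The test \<open>i \<le> n\<close> prevents the truncated
  subtraction \<open>n - i\<close> from contributing spurious copies of \<open>v 0\<close>.\<close>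

lemma expansion_add_scaled:
  fixes u v :: "nat \<Rightarrow> complex^'n^'n" and h :: "nat \<Rightarrow> complex"
  assumes U: "\<forall>\<^sub>F l in at_infinity. (\<lambda>n. (l powi (int N - int n)) *\<^sub>M u n) sums U l"
    and V: "\<forall>\<^sub>F l in at_infinity. (\<lambda>n. (l powi (int M - int n)) *\<^sub>M v n) sums V l"
  shows "\<forall>\<^sub>F l in at_infinity.
    (\<lambda>n. (l powi (int N - int n)) *\<^sub>M (u n + (\<Sum>i=0..k. if i \<le> n then h i *\<^sub>M v (n - i) else 0)))
      sums (U l + (\<Sum>i=0..k. h i * l powi (int N - int M - int i)) *\<^sub>M V l)"
proof -
  have "\<forall>\<^sub>F l in at_infinity. l \<noteq> (0::complex)"
    by (auto simp: eventually_at_infinity intro!: exI[of _ 1])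
  with U V show ?thesis
  proof eventually_elim
    case (elim l)
    have "(\<lambda>n. (l powi (int N - int n)) *\<^sub>M (if i \<le> n then h i *\<^sub>M v (n - i) else 0))
        sums ((h i * l powi (int N - int M - int i)) *\<^sub>M V l)" for i
    proof -
      have *: "(h i * l powi (int N - int M - int i)) *\<^sub>M (l powi (int M - int n)) *\<^sub>M v n =
          (l powi (int N - int (n + i))) *\<^sub>M h i *\<^sub>M v n" for n
      proof -
        have shift: "int N - int (n + i) = (int N - int M - int i) + (int M - int n)" by simp
        have "l powi (int N - int (n + i)) = l powi (int N - int M - int i) * l powi (int M - int n)"
          unfolding shift using elim(3) by (intro power_int_add) simp
        then show ?thesis by (simp add: vec_eq_iff)
      qed
      have "(\<lambda>n. (h i * l powi (int N - int M - int i)) *\<^sub>M (l powi (int M - int n)) *\<^sub>M v n)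
          sums ((h i * l powi (int N - int M - int i)) *\<^sub>M V l)"
        by (rule bounded_linear.sums[OF bounded_bilinear.bounded_linear_right[OF bounded_bilinear_smult_mat] elim(2)])
      then show ?thesis unfolding *
        by (subst sums_zero_iff_shift[of i, symmetric])
           (auto simp: bounded_bilinear.zero_right[OF bounded_bilinear_smult_mat])
    qed
    then have "(\<lambda>n. \<Sum>i=0..k. (l powi (int N - int n)) *\<^sub>M (if i \<le> n then h i *\<^sub>M v (n - i) else 0))
        sums (\<Sum>i=0..k. (h i * l powi (int N - int M - int i)) *\<^sub>M V l)"
      by (intro sums_sum)
    from sums_add[OF elim(1) this] show ?case
      by (simp add: bounded_bilinear.add_right[OF bounded_bilinear_smult_mat]
          bounded_bilinear.sum_right[OF bounded_bilinear_smult_mat]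
          bounded_bilinear.sum_left[OF bounded_bilinear_smult_mat])
  qed
qed

lemma tendsto_powi_at_infinity:
  assumes "n < 0"
  shows "((\<lambda>l :: complex. l powi n) \<longlongrightarrow> 0) at_infinity"
proof -
  have "((\<lambda>l :: complex. inverse l ^ nat (- n)) \<longlongrightarrow> 0 ^ nat (- n)) at_infinity"
    by (intro tendsto_power tendsto_inverse_0)
  moreover have "(0::complex) ^ nat (- n) = 0" using assms by (simp add: power_0_left)
  ultimately show ?thesis using assms by (simp add: power_int_def)
qed

lemma tendsto_smult_powi_at_infinity:
  fixes F :: "complex \<Rightarrow> complex^'n^'n"
  assumes "n < 0" "(F \<longlongrightarrow> A) at_infinity"
  shows "((\<lambda>l. (l powi n) *\<^sub>M F l) \<longlongrightarrow> 0) at_infinity"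
  using tendsto_smult_mat[OF tendsto_powi_at_infinity[OF assms(1)] assms(2)]
  by (simp add: bounded_bilinear.zero_left[OF bounded_bilinear_smult_mat])

text \<open>The determinant is continuous. Applied to \<open>D\<close>, this makes
  \<open>matrix_inv (D x l)\<close> a genuine inverse for large \<open>l\<close>.\<close>

lemma eventually_invertible:
  fixes F :: "'a \<Rightarrow> complex^'n^'n"
  assumes "(F \<longlongrightarrow> A) net" "det A \<noteq> 0"
  shows "\<forall>\<^sub>F x in net. invertible (F x)"
proof -
  have "((\<lambda>x. det (F x)) \<longlongrightarrow> det A) net"
    unfolding det_def by (intro tendsto_intros assms)
  from tendsto_imp_eventually_ne[OF this assms(2)] show ?thesis
    by (simp add: invertible_det_nz)
qed

text \<open>At a fixed point \<open>x\<close>, both sides of \<open>eq\<close> are multiplied by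
  \<open>l powi (int j - int N)\<close> and their limits compared. On the left and in
  \<open>D l ** W l\<close> the leading coefficients appear; of the derivative terms only
  \<open>D1\<close> can survive, and only for \<open>j = N\<close>.\<close>

lemma darboux_leading_coeff:
  fixes D D1 D2 Dl W W' :: "complex \<Rightarrow> complex^'n^'n" and w w' :: "nat \<Rightarrow> complex^'n^'n"
    and L1 L2 H :: "complex \<Rightarrow> complex"
  assumes W: "\<forall>\<^sub>F l in at_infinity. (\<lambda>n. (l powi (int N - int n)) *\<^sub>M w n) sums W l"
    and W': "\<forall>\<^sub>F l in at_infinity. (\<lambda>n. (l powi (int N - int n)) *\<^sub>M w' n) sums W' l"
    and eq: "\<forall>\<^sub>F l in at_infinity. W' l ** D l =
       (D1 l + L1 l *\<^sub>M Dl l) + H l *\<^sub>M (D2 l + L2 l *\<^sub>M Dl l) + D l ** W l"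
    and D: "(D \<longlongrightarrow> T0) at_infinity" "(D1 \<longlongrightarrow> A1) at_infinity" "(D2 \<longlongrightarrow> A2) at_infinity"
      "((\<lambda>l. l\<^sup>2 *\<^sub>M Dl l) \<longlongrightarrow> B) at_infinity"
    and L: "((\<lambda>l. l powi (- N') * L1 l) \<longlongrightarrow> a) at_infinity"
      "((\<lambda>l. l powi (- M') * L2 l) \<longlongrightarrow> b) at_infinity"
    and H: "((\<lambda>l. l powi (int M - int N) * H l) \<longlongrightarrow> c) at_infinity"
    and deg: "N < M" "N' < 2" "int N < int M + 2 - M'" and j: "j \<le> N"
    and w: "\<And>i. i < j \<Longrightarrow> w i = 0" and w': "\<And>i. i < j \<Longrightarrow> w' i = 0"
  shows "w' j ** T0 = T0 ** w j + (if j = N then A1 else 0)"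
proof -
  let ?p = "\<lambda>l. l powi (int j - int N)"
  have ne: "\<forall>\<^sub>F l in at_infinity. l \<noteq> (0::complex)"
    by (auto simp: eventually_at_infinity intro!: exI[of _ 1])
  have "((\<lambda>l. ?p l *\<^sub>M W' l ** D l) \<longlongrightarrow> w' j ** T0) at_infinity"
    by (intro tendsto_matrix_matrix_mult tendsto_lead_coeff_mat[OF W'] w' D)
  \<comment> \<open>The zeros are kept so that the limit has the same bracketing as the five
    summands and can be split term by term.\<close>
  moreover have "((\<lambda>l. ?p l *\<^sub>M W' l ** D l) \<longlongrightarrow>
      ((if j = N then A1 else 0) + 0) + (0 + 0) + T0 ** w j) at_infinity"
  proof (rule Lim_transform_eventually)
    \<comment> \<open>Each derivative term other than the first is written as a power of
      \<open>l\<close> times factors that converge by \<open>D\<close>, \<open>L\<close> and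
      \<open>H\<close>. Since \<open>j \<le> N\<close>, the three inequalities in \<open>deg\<close>
      make the exponents \<open>j - M\<close>, \<open>j - N + N' - 2\<close> and
      \<open>j - M + M' - 2\<close> negative.\<close>
    show "((\<lambda>l. (?p l *\<^sub>M D1 l +
        (l powi (int j - int N + N' - 2)) *\<^sub>M (l powi (- N') * L1 l) *\<^sub>M l\<^sup>2 *\<^sub>M Dl l) +
        ((l powi (int j - int M)) *\<^sub>M (l powi (int M - int N) * H l) *\<^sub>M D2 l +
         (l powi (int j - int M + M' - 2)) *\<^sub>M
           (l powi (int M - int N) * H l) *\<^sub>M (l powi (- M') * L2 l) *\<^sub>M l\<^sup>2 *\<^sub>M Dl l) +
        D l ** ?p l *\<^sub>M W l) \<longlongrightarrow>
      ((if j = N then A1 else 0) + 0) + (0 + 0) + T0 ** w j) at_infinity"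
    proof (intro tendsto_add)
      show "((\<lambda>l. ?p l *\<^sub>M D1 l) \<longlongrightarrow> (if j = N then A1 else 0)) at_infinity"
      proof (cases "j = N")
        case True
        then show ?thesis using D(2) by simp
      next
        case False
        then show ?thesis using j D(2) by (simp add: tendsto_smult_powi_at_infinity)
      qed
    qed (use deg j in \<open>auto intro!: tendsto_smult_powi_at_infinity tendsto_smult_mat D L H
          tendsto_matrix_matrix_mult tendsto_lead_coeff_mat[OF W] w\<close>)
    show "\<forall>\<^sub>F l in at_infinity. (?p l *\<^sub>M D1 l +
        (l powi (int j - int N + N' - 2)) *\<^sub>M (l powi (- N') * L1 l) *\<^sub>M l\<^sup>2 *\<^sub>M Dl l) +
        ((l powi (int j - int M)) *\<^sub>M (l powi (int M - int N) * H l) *\<^sub>M D2 l +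
         (l powi (int j - int M + M' - 2)) *\<^sub>M
           (l powi (int M - int N) * H l) *\<^sub>M (l powi (- M') * L2 l) *\<^sub>M l\<^sup>2 *\<^sub>M Dl l) +
        D l ** ?p l *\<^sub>M W l = ?p l *\<^sub>M W' l ** D l"
      using ne eq
    proof eventually_elim
      case (elim l)
      have p: "l powi m * l powi n = l powi (m + n)" for m n
        using elim(1) by (simp add: power_int_add)
      have sq: "l\<^sup>2 = l powi 2" by simp
      have ss: "x *\<^sub>M y *\<^sub>M X = (x * y) *\<^sub>M X" for x y and X :: "complex^'n^'n"
        by (simp add: vec_eq_iff)
      have e1: "?p l = l powi (int j - int N + N' - 2) * l powi (- N') * l\<^sup>2"
        unfolding sq p by simp
      have e2: "?p l = l powi (int j - int M) * l powi (int M - int N)"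
        unfolding p by simp
      have e3: "?p l = l powi (int j - int M + M' - 2) * l powi (int M - int N) * l powi (- M') * l\<^sup>2"
        unfolding sq p by simp
      have t1: "(l powi (int j - int N + N' - 2)) *\<^sub>M (l powi (- N') * L1 l) *\<^sub>M l\<^sup>2 *\<^sub>M Dl l =
          ?p l *\<^sub>M L1 l *\<^sub>M Dl l"
        unfolding ss e1 by (simp add: ac_simps)
      have t2: "(l powi (int j - int M)) *\<^sub>M (l powi (int M - int N) * H l) *\<^sub>M D2 l =
          ?p l *\<^sub>M H l *\<^sub>M D2 l"
        unfolding ss e2 by (simp add: ac_simps)
      have t3: "(l powi (int j - int M + M' - 2)) *\<^sub>M (l powi (int M - int N) * H l) *\<^sub>M
          (l powi (- M') * L2 l) *\<^sub>M l\<^sup>2 *\<^sub>M Dl l = ?p l *\<^sub>M H l *\<^sub>M L2 l *\<^sub>M Dl l"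
        unfolding ss e3 by (simp add: ac_simps)
      show ?case unfolding t1 t2 t3 smult_mat_matrix_mult elim(2)
        by (simp add: bounded_bilinear.add_right[OF bounded_bilinear_smult_mat])
    qed
  qed
  ultimately have "w' j ** T0 = ((if j = N then A1 else 0) + 0) + (0 + 0) + T0 ** w j"
    by (rule tendsto_unique[OF trivial_limit_at_infinity])
  then show ?thesis by (simp add: add.commute)
qed

section \<open>Invariance of the linear constraints under the Darboux transformation\<close>

theorem proposition8p2:
  fixes \<Omega> :: "(real \<times> real) set"
    and N M k :: nat and N' M' :: int
    and U V D :: "real \<times> real \<Rightarrow> complex \<Rightarrow> complex^'n^'n"
    and u v u' v' T :: "nat \<Rightarrow> real \<times> real \<Rightarrow> complex^'n^'n"
    and L1 L2 :: "real \<times> real \<Rightarrow> complex \<Rightarrow> complex"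
    and a b h :: "nat \<Rightarrow> real \<times> real \<Rightarrow> complex"
    and G :: "(complex^'n^'n) set"
  assumes "open \<Omega>" and "N > 0" and "M > 0"
    and "mat_expansion \<Omega> (int N) u U"
    and "mat_expansion \<Omega> (int M) v V"
    and "expansion \<Omega> N' a L1"
    and "expansion \<Omega> M' b L2"
    and "darboux_transformation \<Omega> N M L1 L2 U V D T u' v'"
    and "Min {int M, int N + 2 - N', int M + 2 - M'} > int N"
    and "k \<le> N"
    and "matrix_lie_group G"
    and "\<forall>x\<in>\<Omega>. T 0 x \<in> G"
    and "linear_constraints \<Omega> (lie_algebra G) k h u v"
  shows "linear_constraints \<Omega> (lie_algebra G) k h u' v'"
proof -
  note dt = assms(8)[unfolded darboux_transformation_def]
  have smooth: "smooth_near_infinity \<Omega> D" and DT: "mat_expansion \<Omega> 0 T D" using dt by auto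
  have deg: "N < M" "N' < 2" "int N < int M + 2 - M'" using assms(9) by auto
  have d1: "\<exists>A. ((\<lambda>s. T 0 (s, snd x)) has_vector_derivative A) (at (fst x)) \<and>
      (dx1 D x \<longlongrightarrow> A) at_infinity" if "x \<in> \<Omega>" for x
  proof -
    have "\<forall>\<^sub>F (x, l) in nhds x \<times>\<^sub>F at_infinity.
       (\<forall>i j. (\<lambda>m. D x m $ i $ j) field_differentiable at l) \<and>
       (\<lambda>t. D (t, snd x) l) differentiable at (fst x) \<and>
       isCont (\<lambda>(y, m). dx1 D y m) (x, l)"
      using smooth that unfolding smooth_near_infinity_def
      by (auto elim!: eventually_mono dest!: bspec)
    then have "\<forall>\<^sub>F (y, l) in nhds x \<times>\<^sub>F at_infinity.
       (\<forall>i j. (\<lambda>m. D y m $ i $ j) field_differentiable at l) \<and>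
       (\<forall>s. y = (s, snd x) \<longrightarrow> ((\<lambda>s. D (s, snd x) l) has_vector_derivative dx1 D y l) (at s)) \<and>
       isCont (\<lambda>(y, m). dx1 D y m) (y, l)"
      by (rule eventually_mono) (auto simp: vector_derivative_works dx1_def)
    moreover have "continuous_on UNIV (\<lambda>s. (s, snd x))" by (intro continuous_intros)
    ultimately show ?thesis
      using leading_coeff_derivative[of \<Omega> "\<lambda>s. (s, snd x)" "fst x" T D "dx1 D"] assms(1) that DT
      by simp
  qed
  \<comment> \<open>In the second variable convergence is enough: the factor \<open>H\<close>, of
    degree at most \<open>N - M\<close>, removes this contribution in the limit.\<close>
  have d2: "\<exists>A. (dx2 D x \<longlongrightarrow> A) at_infinity" if "x \<in> \<Omega>" for x
  proof -
    have "\<forall>\<^sub>F (x, l) in nhds x \<times>\<^sub>F at_infinity.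
       (\<forall>i j. (\<lambda>m. D x m $ i $ j) field_differentiable at l) \<and>
       (\<lambda>t. D (fst x, t) l) differentiable at (snd x) \<and>
       isCont (\<lambda>(y, m). dx2 D y m) (x, l)"
      using smooth that unfolding smooth_near_infinity_def
      by (auto elim!: eventually_mono dest!: bspec)
    then have "\<forall>\<^sub>F (y, l) in nhds x \<times>\<^sub>F at_infinity.
       (\<forall>i j. (\<lambda>m. D y m $ i $ j) field_differentiable at l) \<and>
       (\<forall>s. y = (fst x, s) \<longrightarrow> ((\<lambda>s. D (fst x, s) l) has_vector_derivative dx2 D y l) (at s)) \<and>
       isCont (\<lambda>(y, m). dx2 D y m) (y, l)"
      by (rule eventually_mono) (auto simp: vector_derivative_works dx2_def)
    moreover have "continuous_on UNIV (\<lambda>s. (fst x, s))" by (intro continuous_intros)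
    ultimately show ?thesis
      using leading_coeff_derivative[of \<Omega> "\<lambda>s. (fst x, s)" "snd x" T D "dx2 D"] assms(1) that DT
      by auto
  qed
  show ?thesis unfolding linear_constraints_def
  proof
    fix x assume x: "x \<in> \<Omega>"
    obtain A1 where A1: "((\<lambda>s. T 0 (s, snd x)) has_vector_derivative A1) (at (fst x))"
      "(dx1 D x \<longlongrightarrow> A1) at_infinity" using d1[OF x] by blast
    obtain A2 where A2: "(dx2 D x \<longlongrightarrow> A2) at_infinity" using d2[OF x] by blast
    obtain B where B: "((\<lambda>l. l\<^sup>2 *\<^sub>M dlam D x l) \<longlongrightarrow> B) at_infinity"
      using tendsto_dlam_at_infinity[OF DT x] by blast
    have "\<forall>\<^sub>F l in at_infinity. (\<lambda>k. (l powi (0 - int k)) *\<^sub>M T k x) sums D x l"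
      using DT x by (simp add: mat_expansion_def)
    from tendsto_lead_coeff_mat[OF this, of 0]
    have T0: "(D x \<longlongrightarrow> T 0 x) at_infinity" by simp
    have G: "T 0 x \<in> G" and inv: "T 0 x ** matrix_inv (T 0 x) = mat 1"
      using assms(11,12) x by (auto simp: matrix_lie_group_def intro: matrix_inv_cancel)
    define H where "H l = (\<Sum>i=0..k. h i x * l powi (int N - int M - int i))" for l :: complex
    \<comment> \<open>The coefficient families are arguments, so that \<open>w\<close> serves the
      original and the transformed pair alike. For \<open>n \<le> k\<close> it is the left-hand side
      of a constraint; for larger \<open>n\<close> it is a later coefficient of the same
      expansion.\<close>
    define w where "w u v n = u n x + (\<Sum>i=0..k. if i \<le> n then h i x *\<^sub>M v (n - i) x else 0)"
      for u v :: "nat \<Rightarrow> real \<times> real \<Rightarrow> complex^'n^'n" and n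
    have w_eq: "w u v n = u n x + (\<Sum>i=0..n. h i x *\<^sub>M v (n - i) x)" if "n \<le> k" for u v n
    proof -
      have "(\<Sum>i=0..k. if i \<le> n then h i x *\<^sub>M v (n - i) x else 0) =
          (\<Sum>i=0..n. h i x *\<^sub>M v (n - i) x)"
        using that by (intro sum.mono_neutral_cong_right) auto
      then show ?thesis by (simp add: w_def)
    qed
    have w0: "w u v i = 0" if "i < k" for i
      using assms(13) x that by (simp add: linear_constraints_def w_eq)
    have wk: "w u v k \<in> lie_algebra G"
      using assms(13) x by (simp add: linear_constraints_def w_eq)
    have W: "\<forall>\<^sub>F l in at_infinity. (\<lambda>n. (l powi (int N - int n)) *\<^sub>M w u v n) sums
        (U x l + H l *\<^sub>M V x l)"
      unfolding w_def H_def using assms(4,5) x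
      by (intro expansion_add_scaled) (auto simp: mat_expansion_def)
    have W': "\<forall>\<^sub>F l in at_infinity. (\<lambda>n. (l powi (int N - int n)) *\<^sub>M w u' v' n) sums
        (darboux1 L1 D U x l + H l *\<^sub>M darboux2 L2 D V x l)"
      unfolding w_def H_def using dt x
      by (intro expansion_add_scaled) (auto simp: mat_expansion_def)
    have "\<forall>\<^sub>F l in at_infinity. invertible (D x l)"
      using T0 dt x by (intro eventually_invertible) auto
    \<comment> \<open>The same \<open>H\<close> multiplies the original and the transformed second
      matrix. Being scalar, it commutes with \<open>D x l\<close>, so the two transformation laws,
      multiplied by \<open>D x l\<close> on the right, combine linearly.\<close>
    then have eq: "\<forall>\<^sub>F l in at_infinity. (darboux1 L1 D U x l + H l *\<^sub>M darboux2 L2 D V x l) ** D x l =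
        (dx1 D x l + L1 x l *\<^sub>M dlam D x l) + H l *\<^sub>M (dx2 D x l + L2 x l *\<^sub>M dlam D x l) +
        D x l ** (U x l + H l *\<^sub>M V x l)"
    proof eventually_elim
      case (elim l)
      have c: "X ** matrix_inv (D x l) ** D x l = X" for X
        using matrix_inv_cancel[OF elim] by (simp add: matrix_mul_assoc[symmetric])
      show ?case
        by (simp add: darboux1_def darboux2_def total1_def total2_def smult_mat_matrix_mult c
            bounded_bilinear.add_left[OF bounded_bilinear_matrix_matrix_mult]
            bounded_bilinear.add_right[OF bounded_bilinear_matrix_matrix_mult]
            bounded_bilinear.add_right[OF bounded_bilinear_smult_mat])
    qed
    have L: "((\<lambda>l. l powi (- N') * L1 x l) \<longlongrightarrow> a 0 x) at_infinity"
      "((\<lambda>l. l powi (- M') * L2 x l) \<longlongrightarrow> b 0 x) at_infinity"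
      using tendsto_lead_coeff[of "\<lambda>n. a n x" N' "L1 x" 0] tendsto_lead_coeff[of "\<lambda>n. b n x" M' "L2 x" 0]
        assms(6,7) x by (auto simp: expansion_def)
    \<comment> \<open>\<open>H\<close> is treated as an expansion of degree \<open>N - M\<close>
      with coefficients 0 beyond \<open>k\<close>; \<open>int 0\<close> and the conditional are the
      instance \<open>j = 0\<close> of the leading-coefficient limit.\<close>
    have "((\<lambda>l. l powi (int 0 - (int N - int M)) * H l) \<longlongrightarrow> (if 0 \<le> k then h 0 x else 0)) at_infinity"
    proof (rule tendsto_lead_coeff[of "\<lambda>i. if i \<le> k then h i x else 0"])
      have "(\<lambda>i. (if i \<le> k then h i x else 0) * l powi (int N - int M - int i)) sums H l" for l
        using sums_finite[of "{0..k}" "\<lambda>i. (if i \<le> k then h i x else 0) * l powi (int N - int M - int i)"]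
        unfolding H_def by (simp cong: sum.cong_simp)
      then show "\<forall>\<^sub>F l in at_infinity.
          (\<lambda>i. (if i \<le> k then h i x else 0) * l powi (int N - int M - int i)) sums H l"
        by simp
    qed auto
    then have H: "((\<lambda>l. l powi (int M - int N) * H l) \<longlongrightarrow> h 0 x) at_infinity" by simp
    note lead = darboux_leading_coeff[OF W W' eq T0 A1(2) A2 B L H deg]
    have cancel: "X = Y ** matrix_inv (T 0 x)" if "X ** T 0 x = Y" for X Y
      using inv that by (auto simp: matrix_mul_assoc[symmetric])
    note z = bounded_bilinear.zero_left[OF bounded_bilinear_matrix_matrix_mult]
      bounded_bilinear.zero_right[OF bounded_bilinear_matrix_matrix_mult]
    \<comment> \<open>Strong induction, because reading off the transformed coefficient
      \<open>j\<close> requires the lower ones to vanish. From \<open>j < k\<close> and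
      \<open>k \<le> N\<close> follows \<open>j < N\<close>, so the term with \<open>A1\<close> is
      absent.\<close>
    have w'0: "w u' v' j = 0" if "j < k" for j
      using that
    proof (induction j rule: less_induct)
      case (less j)
      have "w u' v' j ** T 0 x = 0"
        using lead[of j] less w0 assms(10) by (simp add: z)
      from cancel[OF this] show ?case by (simp add: z)
    qed
    have "w u' v' k ** T 0 x = T 0 x ** w u v k + (if k = N then A1 else 0)"
      using lead[of k] w0 w'0 assms(10) by simp
    from cancel[OF this]
    have w'k: "w u' v' k = T 0 x ** w u v k ** matrix_inv (T 0 x) +
        (if k = N then A1 ** matrix_inv (T 0 x) else 0)"
      by (simp add: bounded_bilinear.add_left[OF bounded_bilinear_matrix_matrix_mult])
    \<comment> \<open>The horizontal segment through \<open>x\<close> of half-length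
      \<open>e\<close> stays in the domain. On all of it \<open>T 0\<close> takes values in
      \<open>G\<close> and, by \<open>d1\<close> at each of its points, is differentiable, as
      \<open>lie_algebra\<close> demands on a whole interval.\<close>
    obtain e where e: "e > 0" "ball x e \<subseteq> \<Omega>" using assms(1) x open_contains_ball by blast
    have "A1 ** matrix_inv (T 0 (fst x, snd x)) \<in> lie_algebra G"
    proof (rule lie_algebra_logarithmic_derivative[OF assms(11) e(1) _ A1(1)])
      fix s assume "s \<in> ball (fst x) e"
      then have "(s, snd x) \<in> \<Omega>"
        using e(2) by (cases x) (auto simp: subset_iff dist_Pair_Pair)
      then show "T 0 (s, snd x) \<in> G \<and> (\<lambda>s. T 0 (s, snd x)) differentiable at s"
        using assms(12) d1[of "(s, snd x)"] by (auto intro: differentiableI_vector)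
    qed
    then have "w u' v' k \<in> lie_algebra G"
      using lie_algebra_conjugate[OF assms(11) wk G] lie_algebra_add[OF assms(11)] w'k
      by (cases "k = N") auto
    then show "(\<forall>j<k. u' j x + (\<Sum>i=0..j. h i x *\<^sub>M v' (j - i) x) = 0) \<and>
       u' k x + (\<Sum>i=0..k. h i x *\<^sub>M v' (k - i) x) \<in> lie_algebra G"
      using w'0 by (simp add: w_eq)
  qed
qed

end
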